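(* Let $x_0>0$, $D=[x_0,\infty)$, and let $b:D\to(0,\infty)$ satisfy all of the following. 1) $b\in C^1(D)$, with $b'$ positive and increasing on $D$. 2) There exist positive monotone decreasing functions $F,G\in C^1((0,\infty))$ such that $-\frac{d}{dx}G(b(x))\le \frac{1}{b(x)}\le -\frac{d}{dx}F(b(x))$ for all $x\in D$, with $\lim_{x\to\infty}F(x)=0$, and such that for some $\alpha>-2$, $-\frac{1}{F^{-1}(\epsilon)\,G'(F^{-1}(\epsilon))}=\mathcal{O}(\epsilon^{\alpha})$ for sufficiently small $\epsilon>0$. 3) There exists $k>1$ such that $\int_{x_0}^\infty \frac{\sqrt{b'(kx)}}{b(x)}\,dx<\infty$. 4) The integral $\tau=\int_{x_0}^\infty\frac{1}{b(x)}\,dx$ is finite. Fix such $F$, $G$ and $k$, and for $\epsilon>0$ let $\bar\tau=\bar\tau(\epsilon)$ and $N=N(\epsilon)$ be the output of the one-dimensional adaptive forward Euler algorithm described in the context, run with input $b,x_0,k,F^{-1},\epsilon$. Then, for sufficiently small $\epsilon>0$, $|\bar\tau-\tau|=\mathcal{O}(\epsilon)$ and the computational cost of the method is $\mathcal{O}(\epsilon^{-1})$, i.e. $N=\mathcal{O}(\epsilon^{-1})$.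
   Context: The number $\tau$ is the blow-up time of the autonomous ODE $x'(t)=b(x(t))$, $x(0)=x_0$. One-dimensional adaptive algorithm (input $b,x_0,k,F^{-1},\epsilon>0$): let $r=r(\epsilon)$ be such that $b(r)=F^{-1}(\epsilon)$. Set $\bar x_0=x_0$, $t_0=0$. As long as $\bar x_n<r$, set $$h_n=\sqrt{\frac{\epsilon^2}{b'(\min\{k\bar x_n,\,r\})}},\qquad \bar x_{n+1}=\bar x_n+b(\bar x_n)h_n,\qquad t_{n+1}=t_n+h_n .$$ Let $N$ be the first index $n$ at which the condition $\bar x_n<r$ fails. The output is $\bar\tau=t_N$ and $N$. The computational cost of the method is defined as the number of iterations $N$. The notation $\mathcal{O}(\cdot)$ refers to the limit $\epsilon\downarrow0$: there are constants $C,\epsilon_0>0$, independent of $\epsilon$, such that the bound holds with constant $C$ for all $\epsilon\in(0,\epsilon_0)$. *)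

theory Defs
  imports "HOL-Analysis.Analysis" "HOL-Library.Landau_Symbols"
begin

text \<open>The derivative relative to a set is one-sided at an end point of an interval, so that
  nothing below depends on the values of a function outside its domain.\<close>

definition deriv_on :: "real set \<Rightarrow> (real \<Rightarrow> real) \<Rightarrow> real \<Rightarrow> real" where
  "deriv_on S f x = vector_derivative f (at x within S)"

definition C1_on :: "real set \<Rightarrow> (real \<Rightarrow> real) \<Rightarrow> bool" where
  "C1_on S f \<longleftrightarrow> f differentiable_on S \<and> continuous_on S (deriv_on S f)"

text \<open>The drift \<open>b\<close> has domain \<open>{x0..}\<close>; \<open>Finv\<close> stands for the inverse of \<open>F\<close>.
  The recursion is continued past the stopping index, but only the values up to
  \<open>euler_N\<close> enter the output.\<close>

definition euler_r :: "(real \<Rightarrow> real) \<Rightarrow> real \<Rightarrow> (real \<Rightarrow> real) \<Rightarrow> real \<Rightarrow> real" where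
  "euler_r b x0 Finv \<epsilon> = inv_into {x0..} b (Finv \<epsilon>)"

definition euler_h ::
  "(real \<Rightarrow> real) \<Rightarrow> real \<Rightarrow> real \<Rightarrow> (real \<Rightarrow> real) \<Rightarrow> real \<Rightarrow> real \<Rightarrow> real" where
  "euler_h b x0 k Finv \<epsilon> x =
     sqrt (\<epsilon>\<^sup>2 / deriv_on {x0..} b (min (k * x) (euler_r b x0 Finv \<epsilon>)))"

primrec euler_x ::
  "(real \<Rightarrow> real) \<Rightarrow> real \<Rightarrow> real \<Rightarrow> (real \<Rightarrow> real) \<Rightarrow> real \<Rightarrow> nat \<Rightarrow> real" where
  "euler_x b x0 k Finv \<epsilon> 0 = x0"
| "euler_x b x0 k Finv \<epsilon> (Suc n) =
     euler_x b x0 k Finv \<epsilon> n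
     + b (euler_x b x0 k Finv \<epsilon> n) * euler_h b x0 k Finv \<epsilon> (euler_x b x0 k Finv \<epsilon> n)"

primrec euler_t ::
  "(real \<Rightarrow> real) \<Rightarrow> real \<Rightarrow> real \<Rightarrow> (real \<Rightarrow> real) \<Rightarrow> real \<Rightarrow> nat \<Rightarrow> real" where
  "euler_t b x0 k Finv \<epsilon> 0 = 0"
| "euler_t b x0 k Finv \<epsilon> (Suc n) =
     euler_t b x0 k Finv \<epsilon> n + euler_h b x0 k Finv \<epsilon> (euler_x b x0 k Finv \<epsilon> n)"

definition euler_N ::
  "(real \<Rightarrow> real) \<Rightarrow> real \<Rightarrow> real \<Rightarrow> (real \<Rightarrow> real) \<Rightarrow> real \<Rightarrow> nat" where
  "euler_N b x0 k Finv \<epsilon> =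
     (LEAST n. \<not> euler_x b x0 k Finv \<epsilon> n < euler_r b x0 Finv \<epsilon>)"

definition euler_tau ::
  "(real \<Rightarrow> real) \<Rightarrow> real \<Rightarrow> real \<Rightarrow> (real \<Rightarrow> real) \<Rightarrow> real \<Rightarrow> real" where
  "euler_tau b x0 k Finv \<epsilon> = euler_t b x0 k Finv \<epsilon> (euler_N b x0 k Finv \<epsilon>)"

text \<open>The threshold is well defined and the loop is left after finitely many iterations;
  without this, \<open>inv_into\<close> and \<open>LEAST\<close> above would return arbitrary values.\<close>

definition euler_halts ::
  "(real \<Rightarrow> real) \<Rightarrow> real \<Rightarrow> real \<Rightarrow> (real \<Rightarrow> real) \<Rightarrow> real \<Rightarrow> bool" where
  "euler_halts b x0 k Finv \<epsilon> \<longleftrightarrow>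
     (\<exists>!r. x0 \<le> r \<and> b r = Finv \<epsilon>) \<and>
     (\<exists>n. \<not> euler_x b x0 k Finv \<epsilon> n < euler_r b x0 Finv \<epsilon>)"

end

theory Submission
  imports Defs
begin

text \<open>
  The threshold \<open>r\<close> splits the blow-up time \<open>\<integral> 1 / b\<close>. The part beyond \<open>r\<close> is
  at most \<open>F (b r) = \<epsilon>\<close>, because \<open>1 / b\<close> is dominated by the derivative of \<open>- F (b x)\<close>
  (\<open>tail_error\<close>). Up to \<open>r\<close>, the output \<open>t\<^sub>N\<close> is a left-endpoint quadrature of \<open>\<integral> 1 / b\<close>
  on the grid of the states \<open>X n\<close>, since \<open>h n = (X (n + 1) - X n) / b (X n)\<close>.

  Everything rests on the fact that, for small \<open>\<epsilon>\<close>, no step except the final one goes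
  beyond the point \<open>m n = min (k * X n) r\<close> at which the step size reads the slope of \<open>b\<close>
  (\<open>step_within_m\<close>). As \<open>b'\<close> is increasing, \<open>b' (m n) = (\<epsilon> / h n)\<^sup>2\<close> then bounds
  the slope of \<open>b\<close> along the whole step, with two consequences.

  The quadrature error of the step is at most \<open>b' (m n) * (h n)\<^sup>2 = \<epsilon>\<^sup>2\<close>
  (\<open>local_time_error\<close>), so \<open>N\<close> steps contribute \<open>N * \<epsilon>\<^sup>2\<close>, which is of order \<open>\<epsilon>\<close> once \<open>N\<close> is
  of order \<open>1 / \<epsilon>\<close>. The final step, the only one to which the estimate does not apply, has
  length at most \<open>\<epsilon> / sqrt (b' x0)\<close>.

  Secondly, \<open>b\<close> at most doubles along the step. Then
  \<open>\<epsilon> = h n * sqrt (b' (m n)) = (X (n + 1) - X n) * sqrt (b' (m n)) / b (X n)\<close> is at most twice the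
  integral of \<open>sqrt (b' (k * x)) / b x\<close> over the step (\<open>step_cost\<close>), and summation bounds
  \<open>\<epsilon> * (N - 1)\<close> by twice the integral over the half-line.

  The smallness of \<open>\<epsilon>\<close> enters through \<open>\<epsilon> * sqrt (b' r) \<longlonglongrightarrow> 0\<close>. The lower comparison function
  \<open>G\<close> yields \<open>b' r \<le> - 1 / (b r * G' (b r))\<close> (\<open>slope_le\<close>), hence \<open>\<epsilon>\<^sup>2 * b' r\<close> is of
  order \<open>\<epsilon>\<close> to the power \<open>2 + \<alpha>\<close>, which tends to zero because \<open>\<alpha> > -2\<close>.
\<close>

section \<open>Calculus on half-lines\<close>

lemma at_within_atLeast_neq_bot:
  fixes a x :: real
  assumes "a \<le> x"
  shows "at x within {a..} \<noteq> bot"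
proof -
  have "at_right x \<le> at x within {a..}"
    using assms by (intro at_le) auto
  thus ?thesis
    using trivial_limit_at_right_real[of x] by (auto simp: bot_unique)
qed

lemma C1_on_has_derivative:
  assumes "C1_on S f" "x \<in> S"
  shows "(f has_real_derivative deriv_on S f x) (at x within S)"
  using assms
  by (simp add: C1_on_def differentiable_on_def deriv_on_def vector_derivative_works
      has_real_derivative_iff_has_vector_derivative)

lemma C1_on_has_derivative_at:
  assumes "C1_on S f" "x \<in> S" "open S"
  shows "(f has_real_derivative deriv_on S f x) (at x)"
  using C1_on_has_derivative[OF assms(1,2)] at_within_open[OF assms(2,3)] by simp

lemma deriv_on_eqI:
  assumes "(f has_real_derivative D) (at x within S)" "at x within S \<noteq> bot"
  shows "deriv_on S f x = D"
  using vector_derivative_within[OF assms(2)] assms(1)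
  by (simp add: deriv_on_def has_real_derivative_iff_has_vector_derivative)

lemma antimono_on_imp_deriv_on_nonpos:
  assumes "antimono_on S f" "C1_on S f" "open S" "x \<in> S"
  shows "deriv_on S f x \<le> 0"
proof -
  have "mono_on S (\<lambda>x. - f x)"
    using assms(1) by (simp add: monotone_on_def)
  moreover have "((\<lambda>x. - f x) has_real_derivative - deriv_on S f x) (at x)"
    by (intro derivative_intros C1_on_has_derivative_at assms)
  ultimately have "- deriv_on S f x \<ge> 0"
    by (rule mono_on_imp_deriv_nonneg) (simp add: interior_open assms)
  thus ?thesis by simp
qed

text \<open>The Henstock--Kurzweil integral over an unbounded set is already a limit of integrals over
  large intervals, so bounds on the latter pass to the former.\<close>

lemma integral_atLeast_le:
  fixes f :: "real \<Rightarrow> real"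
  assumes f: "(f has_integral I) {a..}" and B: "\<And>s. s \<ge> r \<Longrightarrow> integral {a..s} f \<le> B"
  shows "I \<le> B"
proof (rule field_le_epsilon)
  fix e :: real assume "e > 0"
  obtain K where K: "K > 0" "\<And>p q. ball 0 K \<subseteq> cbox p q \<Longrightarrow>
      norm (integral (cbox p q) (\<lambda>x. if x \<in> {a..} then f x else 0) - I) < e"
    using f \<open>e > 0\<close> unfolding has_integral_alt' by metis
  define s where "s = max r (max K \<bar>a\<bar>)"
  have "ball 0 K \<subseteq> cbox (-s) s"
    by (auto simp: s_def dist_real_def)
  from K(2)[OF this] have "\<bar>integral {-s..s} (\<lambda>x. if x \<in> {a..} then f x else 0) - I\<bar> < e"
    by simp
  moreover have "integral {-s..s} (\<lambda>x. if x \<in> {a..} then f x else 0) = integral {a..s} f"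
  proof -
    have eq: "{a..} \<inter> {-s..s} = {a..s}"
      by (auto simp: s_def)
    show ?thesis
      using integral_restrict_Int[of "{-s..s}" "{a..}" f] unfolding eq .
  qed
  moreover have "integral {a..s} f \<le> B"
    by (rule B) (simp add: s_def)
  ultimately show "I \<le> B + e" by linarith
qed

section \<open>Drifts with increasing derivative\<close>

locale convex_drift =
  fixes b :: "real \<Rightarrow> real" and x0 :: real
  assumes x0_pos: "x0 > 0"
    and b_pos: "\<And>x. x \<ge> x0 \<Longrightarrow> b x > 0"
    and b_C1: "C1_on {x0..} b"
    and b'_pos: "\<And>x. x \<ge> x0 \<Longrightarrow> deriv_on {x0..} b x > 0"
    and b'_mono: "mono_on {x0..} (deriv_on {x0..} b)"
begin

abbreviation b' :: "real \<Rightarrow> real" where "b' \<equiv> deriv_on {x0..} b"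

lemma b'_le: "x0 \<le> x \<Longrightarrow> x \<le> y \<Longrightarrow> b' x \<le> b' y"
  using b'_mono by (auto simp: monotone_on_def)

lemma b_deriv: "x0 \<le> x \<Longrightarrow> (b has_real_derivative b' x) (at x within {x0..})"
  using C1_on_has_derivative[OF b_C1] by simp

lemma b_continuous: "continuous_on {x0..} b"
  using b_deriv by (auto simp: continuous_on_eq_continuous_within intro: DERIV_continuous)

lemma b_increment_bounds:
  assumes "x0 \<le> x" "x \<le> y"
  shows "b' x * (y - x) \<le> b y - b x" "b y - b x \<le> b' y * (y - x)"
proof -
  have "b' x * (y - x) \<le> b y - b x \<and> b y - b x \<le> b' y * (y - x)"
  proof (cases "x = y")
    case False
    have "\<exists>z\<in>{x<..<y}. b y - b x = (\<lambda>h. b' z * h) (y - x)"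
    proof (rule mvt_simple)
      fix z assume "x \<le> z" "z \<le> y"
      hence "(b has_real_derivative b' z) (at z within {x..y})"
        using assms by (intro DERIV_subset[OF b_deriv]) auto
      thus "(b has_derivative (\<lambda>h. b' z * h)) (at z within {x..y})"
        by (simp add: has_field_derivative_def)
    qed (use False assms in auto)
    then obtain z where "x < z" "z < y" "b y - b x = b' z * (y - x)" by auto
    thus ?thesis
      using assms b'_le[of x z] b'_le[of z y] by (auto intro!: mult_right_mono)
  qed simp
  thus "b' x * (y - x) \<le> b y - b x" "b y - b x \<le> b' y * (y - x)" by auto
qed

lemma b_strict_mono:
  assumes "x0 \<le> x" "x < y"
  shows "b x < b y"
proof -
  have "0 < b' x * (y - x)" using b'_pos assms by simp
  thus ?thesis using b_increment_bounds(1)[of x y] assms by simp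
qed

lemma b_mono: "x0 \<le> x \<Longrightarrow> x \<le> y \<Longrightarrow> b x \<le> b y"
  using b_strict_mono[of x y] by (cases "x = y") auto

lemma b_inj: "inj_on b {x0..}"
proof (rule linorder_inj_onI')
  fix x y assume "x \<in> {x0..}" "x < y"
  thus "b x \<noteq> b y" using b_strict_mono[of x y] by simp
qed

lemma b_at_top: "filterlim b at_top at_top"
proof (rule filterlim_at_top_mono)
  show "filterlim (\<lambda>x. b x0 + b' x0 * (x - x0)) at_top at_top"
    using b'_pos[of x0] filterlim_tendsto_add_at_top[OF tendsto_const filterlim_ident, of "- x0"]
    by (intro filterlim_tendsto_add_at_top[OF tendsto_const]
        filterlim_tendsto_pos_mult_at_top[OF tendsto_const]) auto
  show "\<forall>\<^sub>F x in at_top. b x0 + b' x0 * (x - x0) \<le> b x"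
    using eventually_ge_at_top[of x0] 
  proof eventually_elim
    fix x assume "x0 \<le> x"
    thus "b x0 + b' x0 * (x - x0) \<le> b x" using b_increment_bounds(1)[of x0 x] by simp
  qed
qed

lemma b_range: "y \<ge> b x0 \<Longrightarrow> \<exists>x\<ge>x0. b x = y"
proof -
  assume y: "y \<ge> b x0"
  have "\<forall>\<^sub>F x in at_top. y \<le> b x \<and> x0 \<le> x"
    using b_at_top eventually_ge_at_top[of x0] by (auto simp: filterlim_at_top intro: eventually_conj)
  then obtain z where "y \<le> b z" "x0 \<le> z"
    by (auto simp: eventually_at_top_linorder)
  thus ?thesis
    using IVT'[of b x0 y z] y continuous_on_subset[OF b_continuous] by fastforce
qed

lemma b_compose_deriv:
  assumes "C1_on {0<..} F" "x \<ge> x0"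
  shows "((\<lambda>x. F (b x)) has_real_derivative deriv_on {0<..} F (b x) * b' x) (at x within {x0..})"
proof -
  have "(F has_real_derivative deriv_on {0<..} F (b x)) (at (b x) within b ` {x0..})"
    using assms b_pos by (intro DERIV_subset[OF C1_on_has_derivative]) auto
  from DERIV_image_chain[OF this b_deriv[OF assms(2)]] show ?thesis by (simp add: o_def)
qed

lemma deriv_on_b_compose:
  assumes "C1_on {0<..} F" "x \<ge> x0"
  shows "deriv_on {x0..} (\<lambda>x. F (b x)) x = deriv_on {0<..} F (b x) * b' x"
  using b_compose_deriv[OF assms] at_within_atLeast_neq_bot[OF assms(2)] by (rule deriv_on_eqI)

lemma inverse_b_integrable:
  assumes "x0 \<le> p"
  shows "(\<lambda>x. 1 / b x) integrable_on {p..q}"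
proof (rule integrable_continuous_real)
  show "continuous_on {p..q} (\<lambda>x. 1 / b x)"
  proof (intro continuous_intros continuous_on_subset[OF b_continuous] ballI)
    fix x assume "x \<in> {p..q}"
    thus "b x \<noteq> 0" using b_pos[of x] assms by simp
  qed (use assms in auto)
qed

lemma integral_inverse_b_bounds:
  assumes "x0 \<le> p" "p \<le> q"
  shows "(q - p) / b q \<le> integral {p..q} (\<lambda>x. 1 / b x)"
    and "integral {p..q} (\<lambda>x. 1 / b x) \<le> (q - p) / b p"
proof -
  have "integral {p..q} (\<lambda>x. 1 / b q) \<le> integral {p..q} (\<lambda>x. 1 / b x)"
    using assms b_pos b_mono
    by (intro integral_le inverse_b_integrable) (auto intro!: divide_left_mono mult_pos_pos)
  thus "(q - p) / b q \<le> integral {p..q} (\<lambda>x. 1 / b x)" using assms by simp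
  have "integral {p..q} (\<lambda>x. 1 / b x) \<le> integral {p..q} (\<lambda>x. 1 / b p)"
    using assms b_pos b_mono
    by (intro integral_le inverse_b_integrable) (auto intro!: divide_left_mono mult_pos_pos)
  thus "integral {p..q} (\<lambda>x. 1 / b x) \<le> (q - p) / b p" using assms by simp
qed

end

section \<open>One run of the algorithm\<close>

text \<open>The two smallness conditions hold for all small tolerances as soon as
  \<open>\<epsilon> * sqrt (b' r)\<close> tends to zero with \<open>\<epsilon>\<close>. The first one prevents \<open>b\<close> from more than doubling along a
  step, the second one prevents a step that starts below \<open>r / k\<close> from enlarging the state
  by a factor of more than \<open>k\<close>.\<close>

locale adaptive_run = convex_drift +
  fixes k \<epsilon> r :: real and Finv :: "real \<Rightarrow> real"
  assumes k: "k > 1" and eps_pos: "\<epsilon> > 0"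
    and threshold: "euler_r b x0 Finv \<epsilon> = r" and x0_less_r: "x0 < r"
    and growth_small: "\<epsilon> * sqrt (b' r) \<le> 1"
    and step_small: "\<epsilon> * b x0 / (x0 * sqrt (b' x0)) + \<epsilon> * sqrt (b' r) \<le> k - 1"
begin

abbreviation X :: "nat \<Rightarrow> real" where "X \<equiv> euler_x b x0 k Finv \<epsilon>"
abbreviation h :: "nat \<Rightarrow> real" where "h n \<equiv> euler_h b x0 k Finv \<epsilon> (X n)"
abbreviation m :: "nat \<Rightarrow> real" where "m n \<equiv> min (k * X n) r"
abbreviation N :: nat where "N \<equiv> euler_N b x0 k Finv \<epsilon>"

lemma h_eq: "h n = \<epsilon> / sqrt (b' (m n))"
  using eps_pos by (simp add: euler_h_def threshold real_sqrt_divide)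

lemma X_le_k_X: "x0 \<le> X n \<Longrightarrow> X n \<le> k * X n"
  using k x0_pos by simp

lemma m_ge: "x0 \<le> X n \<Longrightarrow> x0 \<le> m n"
  using X_le_k_X[of n] x0_less_r by simp

lemma X_ge: "x0 \<le> X n"
proof (induction n)
  case (Suc n)
  have "0 \<le> h n"
    using eps_pos b'_pos[OF m_ge[OF Suc]] by (simp add: h_eq)
  hence "0 \<le> b (X n) * h n"
    using b_pos[OF Suc] by simp
  thus ?case using Suc by simp
qed simp

lemma b'_m_pos: "b' (m n) > 0"
  by (intro b'_pos m_ge X_ge)

lemma h_le: "h n \<le> \<epsilon> / sqrt (b' x0)"
  unfolding h_eq using eps_pos b'_pos[of x0] b'_m_pos[of n] b'_le[OF order_refl m_ge[OF X_ge], of n]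
  by (intro divide_left_mono mult_pos_pos) auto

lemma h_ge: "\<epsilon> / sqrt (b' r) \<le> h n"
  unfolding h_eq using eps_pos b'_pos[of r] x0_less_r b'_m_pos[of n] b'_le[OF m_ge[OF X_ge], of n r]
  by (intro divide_left_mono mult_pos_pos) auto

lemma eps_sqrt_b'_m_le: "\<epsilon> * sqrt (b' (m n)) \<le> \<epsilon> * sqrt (b' r)"
  using eps_pos b'_le[OF m_ge[OF X_ge], of n r] by (intro mult_left_mono) auto

lemma h_pos: "h n > 0"
  using eps_pos b'_m_pos[of n] by (simp add: h_eq)

lemma h_times_b': "h n * b' (m n) = \<epsilon> * sqrt (b' (m n))"
proof -
  have "h n * b' (m n) = \<epsilon> * (b' (m n) / sqrt (b' (m n)))"
    unfolding h_eq by (rule times_divide_eq_left[THEN trans]) (rule times_divide_eq_right[symmetric])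
  thus ?thesis using b'_m_pos[of n] by (simp add: real_div_sqrt)
qed

lemma X_mono: "X n \<le> X (Suc n)"
  using h_pos[of n] b_pos[OF X_ge, of n] by simp

text \<open>The slope is never read beyond the threshold, so the step sizes are bounded below and
  the state grows at least linearly with the number of iterations.\<close>

lemma X_reaches_r: "\<exists>n. \<not> X n < r"
proof -
  define c where "c = b x0 * (\<epsilon> / sqrt (b' r))"
  have c: "c > 0"
    using b_pos[of x0] eps_pos b'_pos[of r] x0_less_r by (simp add: c_def)
  have growth: "x0 + real n * c \<le> X n" for n
  proof (induction n)
    case (Suc n)
    have "c \<le> b (X n) * h n"
      unfolding c_def using eps_pos b'_pos[of r] x0_less_r b_pos[OF X_ge, of n] X_ge h_ge b_mono
      by (intro mult_mono) auto
    thus ?case using Suc by (simp add: algebra_simps)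
  qed simp
  obtain n where "r - x0 < real n * c"
    using reals_Archimedean3[OF c] by blast
  moreover have "x0 + real n * c \<le> X n" by (rule growth)
  ultimately have "\<not> X n < r" by linarith
  thus ?thesis ..
qed

lemma X_N_ge: "X N \<ge> r"
  using LeastI_ex[OF X_reaches_r] by (simp add: euler_N_def threshold)

lemma X_less_r: "n < N \<Longrightarrow> X n < r"
  using not_less_Least[of n "\<lambda>n. \<not> X n < r"] by (simp add: euler_N_def threshold)

lemma N_pos: "N > 0"
  using X_N_ge x0_less_r by (cases "N = 0") auto

text \<open>The step size is tuned to the slope of \<open>b\<close> at \<open>m n\<close>, so it controls \<open>b\<close> along the
  step only if the step does not overshoot \<open>m n\<close>. This could happen for \<open>m n = k * X n\<close> only,
  where the convexity bound \<open>b x \<le> b x0 + x * b' (k * x)\<close> keeps the increment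
  \<open>b x * \<epsilon> / sqrt (b' (k * x))\<close> below \<open>(k - 1) * x\<close>.\<close>

lemma step_within_m:
  assumes "X (Suc n) < r"
  shows "X (Suc n) \<le> m n"
proof (cases "k * X n \<le> r")
  case True
  define x s where "x = X n" and "s = sqrt (b' (m n))"
  have m: "m n = k * x" using True by (simp add: x_def)
  have x: "x0 \<le> x" "0 < x" using X_ge[of n] x0_pos by (auto simp: x_def)
  have s: "s > 0" "s * s = b' (m n)" using b'_m_pos[of n] by (auto simp: s_def)
  have s0: "sqrt (b' x0) > 0" "sqrt (b' x0) \<le> s"
    using b'_pos[of x0] b'_le[OF order_refl m_ge[OF X_ge], of n] by (auto simp: s_def)
  have "b x \<le> b x0 + b' x * (x - x0)"
    using b_increment_bounds(2)[of x0 x] x by simp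
  also have "b' x * (x - x0) \<le> b' (m n) * x"
    using x x0_pos b'_m_pos[of n] b'_le[of x "m n"] X_le_k_X[OF X_ge, of n]
    by (intro mult_mono) (auto simp: m x_def)
  finally have "b x \<le> b x0 + s * s * x" by (simp add: s)
  hence "b x * (\<epsilon> / s) \<le> (b x0 + s * s * x) * (\<epsilon> / s)"
    using eps_pos s by (intro mult_right_mono) auto
  also have "\<dots> = \<epsilon> * b x0 / s + \<epsilon> * s * x"
    using s by (simp add: field_simps)
  also have "\<epsilon> * b x0 / s \<le> \<epsilon> * b x0 / sqrt (b' x0)"
    using eps_pos b_pos[of x0] by (intro divide_left_mono[OF s0(2)] mult_pos_pos[OF s(1) s0(1)]) simp
  also have "\<dots> = \<epsilon> * b x0 / (x0 * sqrt (b' x0)) * x0"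
    using x0_pos by simp
  also have "\<dots> \<le> \<epsilon> * b x0 / (x0 * sqrt (b' x0)) * x"
    using x eps_pos b_pos[of x0] x0_pos s0 by (intro mult_left_mono) auto
  also have "\<epsilon> * b x0 / (x0 * sqrt (b' x0)) * x + \<epsilon> * s * x
      \<le> \<epsilon> * b x0 / (x0 * sqrt (b' x0)) * x + \<epsilon> * sqrt (b' r) * x"
    unfolding s_def using x eps_sqrt_b'_m_le[of n] by (intro add_left_mono mult_right_mono) auto
  also have "\<dots> \<le> (k - 1) * x"
    using mult_right_mono[OF step_small, of x] x by (simp add: distrib_right)
  finally have "b x * h n \<le> (k - 1) * x" by (simp add: h_eq s_def)
  thus ?thesis
    unfolding m by (simp add: x_def algebra_simps)
qed (use assms in simp)

lemma b_increment_on_step: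
  assumes "X (Suc n) < r" "X n \<le> x" "x \<le> X (Suc n)"
  shows "b x - b (X n) \<le> b' (m n) * (b (X n) * h n)"
proof -
  have "b x - b (X n) \<le> b' x * (x - X n)"
    using b_increment_bounds(2) X_ge assms by blast
  also have "\<dots> \<le> b' (m n) * (b (X n) * h n)"
  proof (intro mult_mono)
    show "b' x \<le> b' (m n)"
      using b'_le[of x "m n"] step_within_m[OF assms(1)] assms X_ge[of n] by linarith
  qed (use assms b'_m_pos[of n] in auto)
  finally show ?thesis .
qed

lemma b_doubles_at_most:
  assumes "X (Suc n) < r" "X n \<le> x" "x \<le> X (Suc n)"
  shows "b x \<le> 2 * b (X n)"
proof -
  have "b x - b (X n) \<le> b (X n) * (h n * b' (m n))"
    using b_increment_on_step[OF assms] by (simp add: mult_ac)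
  also have "\<dots> \<le> b (X n) * 1"
    unfolding h_times_b' using eps_sqrt_b'_m_le[of n] growth_small b_pos[OF X_ge, of n]
    by (intro mult_left_mono) auto
  finally show ?thesis by simp
qed

text \<open>Left-endpoint quadrature of \<open>1 / b\<close> has an error of at most the step length times the
  variation of \<open>1 / b\<close>; the step size makes this product equal to \<open>\<epsilon>\<^sup>2\<close>.\<close>

lemma local_time_error:
  assumes "X (Suc n) < r"
  shows "\<bar>h n - integral {X n..X (Suc n)} (\<lambda>x. 1 / b x)\<bar> \<le> \<epsilon>\<^sup>2"
proof -
  define B B1 where "B = b (X n)" and "B1 = b (X (Suc n))"
  have B: "0 < B" "B \<le> B1"
    using b_pos[OF X_ge, of n] b_mono[OF X_ge X_mono, of n] by (auto simp: B_def B1_def)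
  have "integral {X n..X (Suc n)} (\<lambda>x. 1 / b x) \<le> B * h n / B"
    using integral_inverse_b_bounds(2)[OF X_ge X_mono, of n] by (simp add: B_def)
  hence upper: "integral {X n..X (Suc n)} (\<lambda>x. 1 / b x) \<le> h n" using B by simp
  have lower: "B * h n / B1 \<le> integral {X n..X (Suc n)} (\<lambda>x. 1 / b x)"
    using integral_inverse_b_bounds(1)[OF X_ge X_mono, of n] by (simp add: B_def B1_def)
  have "h n - B * h n / B1 = (B1 - B) * h n / B1"
    using B by (simp add: field_simps)
  also have "\<dots> \<le> (b' (m n) * (B * h n)) * h n / B"
    using B b_increment_on_step[OF assms X_mono order_refl] h_pos[of n] b'_m_pos[of n]
    by (intro frac_le mult_right_mono mult_nonneg_nonneg) (auto simp: B_def B1_def)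
  also have "\<dots> = (h n * b' (m n)) * h n"
    using B by simp
  also have "\<dots> = \<epsilon>\<^sup>2"
    unfolding h_times_b' using b'_m_pos[of n] by (simp add: h_eq power2_eq_square)
  finally show ?thesis using upper lower by linarith
qed

text \<open>By the choice of \<open>h n\<close> a step is worth \<open>h n * sqrt (b' (m n)) / \<epsilon> = 1\<close>, and
  \<open>h n\<close> is the increment of the state divided by \<open>b\<close> at the left end point. Hence counting
  steps is integrating \<open>sqrt (b' (k * x)) / b x\<close>, up to the factor lost on replacing \<open>b (X n)\<close>
  by \<open>b x\<close>.\<close>

lemma step_cost:
  assumes "X (Suc n) < r"
    and int: "(\<lambda>x. sqrt (b' (k * x)) / b x) integrable_on {X n..X (Suc n)}"
  shows "\<epsilon> \<le> 2 * integral {X n..X (Suc n)} (\<lambda>x. sqrt (b' (k * x)) / b x)"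
proof -
  define B where "B = b (X n)"
  have B: "B > 0" using b_pos[OF X_ge] by (simp add: B_def)
  have "integral {X n..X (Suc n)} (\<lambda>x. sqrt (b' (m n)) / (2 * B))
      \<le> integral {X n..X (Suc n)} (\<lambda>x. sqrt (b' (k * x)) / b x)"
  proof (rule integral_le)
    fix x assume x: "x \<in> {X n..X (Suc n)}"
    have "x0 \<le> x" using x X_ge[of n] by auto
    have "m n \<le> k * X n" by simp
    also have "\<dots> \<le> k * x" using x k by simp
    finally have "b' (m n) \<le> b' (k * x)" by (rule b'_le[OF m_ge[OF X_ge]])
    thus "sqrt (b' (m n)) / (2 * B) \<le> sqrt (b' (k * x)) / b x"
      using b_doubles_at_most[OF assms(1), of x] x b_pos[OF \<open>x0 \<le> x\<close>] b'_m_pos[of n]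
      by (intro frac_le) (auto simp: B_def)
  qed (use int in auto)
  also have "integral {X n..X (Suc n)} (\<lambda>x. sqrt (b' (m n)) / (2 * B)) = \<epsilon> / 2"
    using X_mono[of n] B b'_m_pos[of n] by (simp add: h_eq B_def)
  finally show ?thesis by simp
qed

lemma cost_bound:
  assumes int: "(\<lambda>x. sqrt (b' (k * x)) / b x) integrable_on {x0..}"
  shows "real N \<le> 1 + 2 / \<epsilon> * integral {x0..} (\<lambda>x. sqrt (b' (k * x)) / b x)"
proof -
  let ?g = "\<lambda>x. sqrt (b' (k * x)) / b x"
  have sub: "?g integrable_on {p..q}" if "x0 \<le> p" for p q
    using int by (rule integrable_on_subinterval) (use that in auto)
  have steps: "X n < r \<Longrightarrow> real n * \<epsilon> \<le> 2 * integral {x0..X n} ?g" for n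
  proof (induction n)
    case (Suc n)
    hence "real n * \<epsilon> \<le> 2 * integral {x0..X n} ?g"
      using X_mono[of n] by simp
    moreover have "\<epsilon> \<le> 2 * integral {X n..X (Suc n)} ?g"
      using step_cost[OF Suc.prems sub[OF X_ge]] .
    moreover have "integral {x0..X n} ?g + integral {X n..X (Suc n)} ?g = integral {x0..X (Suc n)} ?g"
      by (rule Henstock_Kurzweil_Integration.integral_combine[OF X_ge X_mono sub[OF order_refl]])
    ultimately show ?case by (simp add: distrib_right del: euler_x.simps)
  qed simp
  have "real (N - 1) * \<epsilon> \<le> 2 * integral {x0..X (N - 1)} ?g"
    by (intro steps X_less_r) (use N_pos in simp)
  also have "integral {x0..X (N - 1)} ?g \<le> integral {x0..} ?g"
  proof (intro integral_subset_le ballI)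
    fix x assume "x \<in> {x0..}"
    hence "x0 \<le> x" by simp
    moreover have "x \<le> k * x" using k x0_pos \<open>x0 \<le> x\<close> by simp
    ultimately show "0 \<le> ?g x"
      using b'_pos[of "k * x"] b_pos[of x] by simp
  qed (use int sub in auto)
  finally have "real (N - 1) \<le> 2 / \<epsilon> * integral {x0..} ?g"
    using eps_pos by (simp add: field_simps)
  thus ?thesis using N_pos by (simp add: of_nat_diff)
qed

text \<open>The final step may overshoot the threshold and leave the region where its size controls \<open>b\<close>.
  It is harmless because each single step, and with it the time that the exact
  solution needs from \<open>X (N - 1)\<close> to \<open>r\<close>, is of order \<open>\<epsilon>\<close>.\<close>

lemma time_error_up_to_r:
  "\<bar>euler_tau b x0 k Finv \<epsilon> - integral {x0..r} (\<lambda>x. 1 / b x)\<bar>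
    \<le> real N * \<epsilon>\<^sup>2 + \<epsilon> / sqrt (b' x0)"
proof -
  let ?f = "\<lambda>x. 1 / b x" and ?t = "euler_t b x0 k Finv \<epsilon>"
  have err: "X n < r \<Longrightarrow> \<bar>?t n - integral {x0..X n} ?f\<bar> \<le> real n * \<epsilon>\<^sup>2" for n
  proof (induction n)
    case (Suc n)
    hence "\<bar>?t n - integral {x0..X n} ?f\<bar> \<le> real n * \<epsilon>\<^sup>2"
      using X_mono[of n] by simp
    moreover have "\<bar>h n - integral {X n..X (Suc n)} ?f\<bar> \<le> \<epsilon>\<^sup>2"
      using local_time_error[OF Suc.prems] .
    moreover have "integral {x0..X n} ?f + integral {X n..X (Suc n)} ?f = integral {x0..X (Suc n)} ?f"
      by (rule Henstock_Kurzweil_Integration.integral_combine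
          [OF X_ge X_mono inverse_b_integrable[OF order_refl]])
    moreover have "?t (Suc n) = ?t n + h n" by simp
    moreover have "real (Suc n) * \<epsilon>\<^sup>2 = real n * \<epsilon>\<^sup>2 + \<epsilon>\<^sup>2" by (simp add: algebra_simps)
    ultimately show ?case by linarith
  qed simp
  obtain M where M: "N = Suc M" using N_pos gr0_implies_Suc by blast
  have XM: "X M < r" "r \<le> X (Suc M)" using X_less_r[of M] X_N_ge M by auto
  have comb: "integral {x0..X M} ?f + integral {X M..r} ?f = integral {x0..r} ?f"
    using XM by (intro Henstock_Kurzweil_Integration.integral_combine
        X_ge inverse_b_integrable) auto
  have BM: "b (X M) > 0" using b_pos X_ge by blast
  have "integral {X M..r} ?f \<le> (r - X M) / b (X M)"
    using integral_inverse_b_bounds(2)[OF X_ge] XM by simp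
  also have "\<dots> \<le> h M"
    using XM BM by (simp add: pos_divide_le_eq mult.commute)
  finally have up: "integral {X M..r} ?f \<le> h M" .
  have lo: "0 \<le> integral {X M..r} ?f"
    using X_ge[of M] b_pos by (intro integral_nonneg inverse_b_integrable) (auto simp: less_imp_le)
  have "\<bar>?t M - integral {x0..X M} ?f\<bar> \<le> real M * \<epsilon>\<^sup>2" by (rule err[OF XM(1)])
  moreover have "real M * \<epsilon>\<^sup>2 \<le> real N * \<epsilon>\<^sup>2" using M by (simp add: mult_right_mono)
  moreover have "euler_tau b x0 k Finv \<epsilon> = ?t M + h M" by (simp add: euler_tau_def M)
  ultimately show ?thesis using up lo comb h_le[of M] h_pos[of M] by linarith
qed

end

section \<open>The stopping threshold\<close>

locale blowup_bound = convex_drift +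
  fixes F Finv :: "real \<Rightarrow> real"
  assumes F_C1: "C1_on {0<..} F"
    and F_pos: "\<And>y. y > 0 \<Longrightarrow> F y > 0"
    and F_antimono: "antimono_on {0<..} F"
    and F_bound: "\<And>x. x \<ge> x0 \<Longrightarrow> 1 / b x \<le> - deriv_on {x0..} (\<lambda>x. F (b x)) x"
    and F_lim: "(F \<longlongrightarrow> 0) at_top"
    and Finv: "Finv = inv_into {0<..} F"
begin

lemma F_b_deriv:
  assumes "x0 \<le> x"
  shows "((\<lambda>x. F (b x)) has_real_derivative deriv_on {x0..} (\<lambda>x. F (b x)) x) (at x within {x0..})"
  using b_compose_deriv[OF F_C1 assms] deriv_on_b_compose[OF F_C1 assms] by simp

lemma integral_inverse_b_le:
  assumes "x0 \<le> p" "p \<le> q"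
  shows "integral {p..q} (\<lambda>x. 1 / b x) \<le> F (b p) - F (b q)"
proof -
  have FTC: "((\<lambda>x. deriv_on {x0..} (\<lambda>x. F (b x)) x) has_integral F (b q) - F (b p)) {p..q}"
  proof (rule fundamental_theorem_of_calculus[OF assms(2)])
    fix x assume "x \<in> {p..q}"
    thus "((\<lambda>x. F (b x)) has_vector_derivative deriv_on {x0..} (\<lambda>x. F (b x)) x) (at x within {p..q})"
      using assms unfolding has_real_derivative_iff_has_vector_derivative[symmetric]
      by (intro DERIV_subset[OF F_b_deriv]) auto
  qed
  have "integral {p..q} (\<lambda>x. 1 / b x) \<le> - (F (b q) - F (b p))"
  proof (rule has_integral_le[OF _ has_integral_neg[OF FTC]])
    show "((\<lambda>x. 1 / b x) has_integral integral {p..q} (\<lambda>x. 1 / b x)) {p..q}"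
      using inverse_b_integrable[OF assms(1)] by (rule integrable_integral)
    fix x assume "x \<in> {p..q}"
    thus "1 / b x \<le> - deriv_on {x0..} (\<lambda>x. F (b x)) x"
      using assms by (intro F_bound) simp
  qed
  thus ?thesis by simp
qed

lemma F_b_strict_antimono:
  assumes "x0 \<le> x" "x < y"
  shows "F (b y) < F (b x)"
proof -
  have "0 < (y - x) / b y"
    using assms b_pos[of y] by simp
  also have "\<dots> \<le> F (b x) - F (b y)"
    using integral_inverse_b_bounds(1)[of x y] integral_inverse_b_le[of x y] assms by simp
  finally show ?thesis by simp
qed

text \<open>\<open>F\<close> may be constant below \<open>b x0\<close>; for \<open>\<epsilon> < F (b x0)\<close> monotonicity places all
  preimages of \<open>\<epsilon>\<close> in the range of \<open>b\<close>, where \<open>F\<close> is strictly decreasing.\<close>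

lemma threshold_exists:
  assumes "0 < \<epsilon>" "\<epsilon> < F (b x0)"
  obtains r where "x0 < r" "F (b r) = \<epsilon>" "Finv \<epsilon> = b r" "euler_r b x0 Finv \<epsilon> = r"
    "\<exists>!y. 0 < y \<and> F y = \<epsilon>" "\<exists>!r. x0 \<le> r \<and> b r = Finv \<epsilon>"
proof -
  have "((\<lambda>x. F (b x)) \<longlongrightarrow> 0) at_top"
    using filterlim_compose[OF F_lim b_at_top] .
  hence "\<forall>\<^sub>F x in at_top. F (b x) < \<epsilon> \<and> x0 \<le> x"
    using assms eventually_ge_at_top by (intro eventually_conj order_tendstoD) auto
  then obtain z where z: "F (b z) < \<epsilon>" "x0 \<le> z"
    by (auto simp: eventually_at_top_linorder)
  have "continuous_on {x0..} (\<lambda>x. F (b x))"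
    using F_b_deriv by (auto simp: continuous_on_eq_continuous_within intro: DERIV_continuous)
  hence "continuous_on {x0..z} (\<lambda>x. F (b x))"
    by (rule continuous_on_subset) auto
  from IVT2'[OF _ _ z(2) this, of \<epsilon>] assms z obtain r where r: "x0 \<le> r" "F (b r) = \<epsilon>"
    by auto
  have unique: "y = b r" if "0 < y" "F y = \<epsilon>" for y
  proof -
    have "b x0 \<le> y"
    proof (rule ccontr)
      assume "\<not> b x0 \<le> y"
      hence "F (b x0) \<le> F y"
        using monotone_onD[OF F_antimono, of y "b x0"] that(1) b_pos[of x0] by simp
      thus False using that(2) assms by simp
    qed
    then obtain s where "x0 \<le> s" "b s = y" using b_range by blast
    thus ?thesis
      using F_b_strict_antimono[of r s] F_b_strict_antimono[of s r] r that
      by (cases r s rule: linorder_cases) auto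
  qed
  have Finv_eq: "Finv \<epsilon> = b r"
  proof (rule unique)
    have "\<epsilon> \<in> F ` {0<..}" using r b_pos[of r] by auto
    thus "0 < Finv \<epsilon>" "F (Finv \<epsilon>) = \<epsilon>"
      using inv_into_into[of \<epsilon> F "{0<..}"] f_inv_into_f[of \<epsilon> F "{0<..}"] by (auto simp: Finv)
  qed
  show ?thesis
  proof
    show "x0 < r" using r assms by (cases "r = x0") auto
    show "euler_r b x0 Finv \<epsilon> = r"
      using inv_into_f_f[OF b_inj, of r] r by (simp add: euler_r_def Finv_eq)
    show "\<exists>!y. 0 < y \<and> F y = \<epsilon>" using unique r b_pos[of r] by blast
    show "\<exists>!s. x0 \<le> s \<and> b s = Finv \<epsilon>"
      using r inj_onD[OF b_inj] by (auto simp: Finv_eq)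
  qed (use r Finv_eq in auto)
qed

text \<open>The comparison \<open>1 / b x \<le> - (F (b x))'\<close> bounds the time that the solution needs
  from \<open>r\<close> to infinity by \<open>F (b r)\<close>.\<close>

lemma tail_error:
  assumes \<tau>: "((\<lambda>x. 1 / b x) has_integral \<tau>) {x0..}" and "x0 \<le> r"
  shows "\<bar>\<tau> - integral {x0..r} (\<lambda>x. 1 / b x)\<bar> \<le> F (b r)"
proof -
  let ?f = "\<lambda>x. 1 / b x"
  have "\<tau> \<le> integral {x0..r} ?f + F (b r)"
  proof (rule integral_atLeast_le[OF \<tau>])
    fix s assume s: "r \<le> s"
    have "integral {x0..r} ?f + integral {r..s} ?f = integral {x0..s} ?f"
      using assms s by (intro Henstock_Kurzweil_Integration.integral_combine inverse_b_integrable) auto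
    moreover have "F (b s) > 0" using F_pos b_pos assms s by simp
    ultimately show "integral {x0..s} ?f \<le> integral {x0..r} ?f + F (b r)"
      using integral_inverse_b_le[of r s] assms s by simp
  qed
  moreover have "integral {x0..r} ?f \<le> integral {x0..} ?f"
    using \<tau> b_pos inverse_b_integrable[OF order_refl]
    by (intro integral_subset_le) (auto simp: less_imp_le)
  hence "integral {x0..r} ?f \<le> \<tau>" using integral_unique[OF \<tau>] by simp
  ultimately show ?thesis using F_pos[OF b_pos[OF assms(2)]] by linarith
qed

text \<open>Since \<open>(G (b x))' = G' (b x) * b' x\<close>, a lower bound on this derivative is an upper bound on
  the slope of \<open>b\<close>; the antimonotonicity of \<open>G\<close> supplies the sign needed for the division.\<close>

lemma slope_le:
  assumes G_C1: "C1_on {0<..} G" and G_antimono: "antimono_on {0<..} G"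
    and G_bound: "- deriv_on {x0..} (\<lambda>x. G (b x)) x \<le> 1 / b x"
    and x: "x0 \<le> x" and nz: "deriv_on {0<..} G (b x) \<noteq> 0"
  shows "b' x \<le> - (1 / (b x * deriv_on {0<..} G (b x)))"
proof -
  define d where "d = - deriv_on {0<..} G (b x)"
  have "deriv_on {0<..} G (b x) \<le> 0"
    by (rule antimono_on_imp_deriv_on_nonpos[OF G_antimono G_C1]) (use b_pos[OF x] in auto)
  hence d: "d > 0"
    using nz unfolding d_def by linarith
  have "d * b' x = - deriv_on {x0..} (\<lambda>x. G (b x)) x"
    unfolding deriv_on_b_compose[OF G_C1 x] d_def by simp
  hence "d * b' x \<le> 1 / b x"
    using G_bound by simp
  hence "b' x \<le> 1 / b x / d"
    using d by (subst pos_le_divide_eq) (auto simp: mult.commute)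
  also have "\<dots> = - (1 / (b x * deriv_on {0<..} G (b x)))"
    by (simp add: d_def)
  finally show ?thesis .
qed

end

section \<open>Convergence\<close>

theorem theorem1:
  fixes x0 k \<alpha> \<tau> :: real and b F G Finv :: "real \<Rightarrow> real"
  assumes x0_pos: "x0 > 0"
    and b_pos: "\<And>x. x \<ge> x0 \<Longrightarrow> b x > 0"
    and b_C1: "C1_on {x0..} b"
    and b'_pos: "\<And>x. x \<ge> x0 \<Longrightarrow> deriv_on {x0..} b x > 0"
    and b'_mono: "mono_on {x0..} (deriv_on {x0..} b)"
    and F_C1: "C1_on {0<..} F"
    and F_pos: "\<And>y. y > 0 \<Longrightarrow> F y > 0"
    and F_antimono: "antimono_on {0<..} F"
    and G_C1: "C1_on {0<..} G"
    and G_pos: "\<And>y. y > 0 \<Longrightarrow> G y > 0"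
    and G_antimono: "antimono_on {0<..} G"
    and G_bound: "\<And>x. x \<ge> x0 \<Longrightarrow> - deriv_on {x0..} (\<lambda>x. G (b x)) x \<le> 1 / b x"
    and F_bound: "\<And>x. x \<ge> x0 \<Longrightarrow> 1 / b x \<le> - deriv_on {x0..} (\<lambda>x. F (b x)) x"
    and F_lim: "(F \<longlongrightarrow> 0) at_top"
    and Finv: "Finv = inv_into {0<..} F"
    and \<alpha>: "\<alpha> > -2"
    and G'_nz: "eventually (\<lambda>\<epsilon>. deriv_on {0<..} G (Finv \<epsilon>) \<noteq> 0) (at_right 0)"
    and growth: "(\<lambda>\<epsilon>. - (1 / (Finv \<epsilon> * deriv_on {0<..} G (Finv \<epsilon>))))
                   \<in> O[at_right 0](\<lambda>\<epsilon>. \<epsilon> powr \<alpha>)"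
    and k: "k > 1"
    and cost_integrable: "(\<lambda>x. sqrt (deriv_on {x0..} b (k * x)) / b x) integrable_on {x0..}"
    and \<tau>: "((\<lambda>x. 1 / b x) has_integral \<tau>) {x0..}"
  shows "eventually (\<lambda>\<epsilon>. (\<exists>!y. 0 < y \<and> F y = \<epsilon>) \<and> euler_halts b x0 k Finv \<epsilon>) (at_right 0)
       \<and> (\<lambda>\<epsilon>. \<bar>euler_tau b x0 k Finv \<epsilon> - \<tau>\<bar>) \<in> O[at_right 0](\<lambda>\<epsilon>. \<epsilon>)
       \<and> (\<lambda>\<epsilon>. real (euler_N b x0 k Finv \<epsilon>)) \<in> O[at_right 0](\<lambda>\<epsilon>. 1 / \<epsilon>)"
proof -
  interpret blowup_bound b x0 F Finv
    by unfold_locales (erule b_pos b'_pos F_pos F_bound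
        | rule x0_pos b_C1 b'_mono F_C1 F_antimono F_lim Finv)+
  define I where "I = integral {x0..} (\<lambda>x. sqrt (b' (k * x)) / b x)"
  define A where "A = b x0 / (x0 * sqrt (b' x0))"
  \<comment> \<open>The two smallness conditions of a run both follow from \<open>\<epsilon> * sqrt (b' r) \<le> \<delta>\<close> and
    \<open>\<epsilon> * A \<le> (k - 1) / 2\<close>.\<close>
  define \<delta> where "\<delta> = min 1 ((k - 1) / 2)"
  have \<delta>: "\<delta> > 0" using k by (simp add: \<delta>_def)
  obtain C where C: "C > 0"
    "\<forall>\<^sub>F \<epsilon> in at_right 0. \<bar>1 / (Finv \<epsilon> * deriv_on {0<..} G (Finv \<epsilon>))\<bar> \<le> C * \<epsilon> powr \<alpha>"
    using landau_o.bigE[OF growth] by auto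

  have "((\<lambda>\<epsilon>. C * \<epsilon> powr (\<alpha> + 2)) \<longlongrightarrow> C * 0 powr (\<alpha> + 2)) (at_right 0)"
    using \<alpha> by (intro tendsto_intros) (auto intro: eventually_at_right_less[THEN eventually_mono])
  hence growth_small: "\<forall>\<^sub>F \<epsilon> in at_right 0. C * \<epsilon> powr (\<alpha> + 2) < \<delta>\<^sup>2"
    using \<delta> by (intro order_tendstoD(2)) auto
  have "((\<lambda>\<epsilon>. \<epsilon> * A) \<longlongrightarrow> 0 * A) (at_right 0)"
    by (intro tendsto_intros)
  hence step_small: "\<forall>\<^sub>F \<epsilon> in at_right 0. \<epsilon> * A < (k - 1) / 2"
    using k by (intro order_tendstoD(2)) auto
  have small: "\<forall>\<^sub>F \<epsilon> in at_right 0. \<epsilon> < min 1 (F (b x0))"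
    using F_pos[OF b_pos[OF order_refl]] by (intro order_tendstoD(2)[OF tendsto_ident_at]) auto

  have main: "\<forall>\<^sub>F \<epsilon> in at_right 0. 0 < \<epsilon>
      \<and> ((\<exists>!y. 0 < y \<and> F y = \<epsilon>) \<and> euler_halts b x0 k Finv \<epsilon>)
      \<and> \<bar>euler_tau b x0 k Finv \<epsilon> - \<tau>\<bar> \<le> (2 + 2 * I + 1 / sqrt (b' x0)) * \<epsilon>
      \<and> real (euler_N b x0 k Finv \<epsilon>) \<le> (1 + 2 * I) * (1 / \<epsilon>)"
    using eventually_at_right_less C(2) G'_nz growth_small step_small small
  proof eventually_elim
    case (elim \<epsilon>)
    hence eps: "0 < \<epsilon>" "\<epsilon> < 1" "\<epsilon> < F (b x0)" by auto
    from threshold_exists[OF eps(1,3)] obtain r where r: "x0 < r" "F (b r) = \<epsilon>" "Finv \<epsilon> = b r"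
      "euler_r b x0 Finv \<epsilon> = r" and unique: "\<exists>!y. 0 < y \<and> F y = \<epsilon>" "\<exists>!r. x0 \<le> r \<and> b r = Finv \<epsilon>"
      by blast
    have "b' r \<le> - (1 / (b r * deriv_on {0<..} G (b r)))"
      using slope_le[OF G_C1 G_antimono G_bound] r elim by simp
    also have "\<dots> \<le> C * \<epsilon> powr \<alpha>"
      by (rule abs_le_D2[OF elim(2)[unfolded r(3)]])
    finally have "\<epsilon>\<^sup>2 * b' r \<le> \<epsilon>\<^sup>2 * (C * \<epsilon> powr \<alpha>)"
      by (intro mult_left_mono) auto
    also have "\<dots> = C * \<epsilon> powr (\<alpha> + 2)"
      using eps by (simp add: powr_add)
    finally have "(\<epsilon> * sqrt (b' r))\<^sup>2 \<le> \<delta>\<^sup>2"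
      using elim r b'_pos[of r] by (simp add: power_mult_distrib)
    hence slope_small: "\<epsilon> * sqrt (b' r) \<le> \<delta>"
      by (rule power2_le_imp_le) (use \<delta> in simp)
    interpret adaptive_run b x0 k \<epsilon> r Finv
    proof unfold_locales
      show "\<epsilon> * sqrt (b' r) \<le> 1" using slope_small by (simp add: \<delta>_def)
      show "\<epsilon> * b x0 / (x0 * sqrt (b' x0)) + \<epsilon> * sqrt (b' r) \<le> k - 1"
        using add_mono[OF less_imp_le[OF elim(5)] order_trans[OF slope_small[unfolded \<delta>_def] min.cobounded2]]
        by (simp add: A_def)
    qed (use k eps r in auto)
    have "real N \<le> 1 + 2 / \<epsilon> * I"
      unfolding I_def by (rule cost_bound[OF cost_integrable])
    also have "\<dots> \<le> 1 / \<epsilon> + 2 / \<epsilon> * I"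
      using eps by simp
    also have "\<dots> = (1 + 2 * I) * (1 / \<epsilon>)"
      by (simp add: add_divide_distrib)
    finally have N_le: "real N \<le> (1 + 2 * I) * (1 / \<epsilon>)" .
    have "real N * \<epsilon>\<^sup>2 \<le> (1 + 2 * I) * (1 / \<epsilon>) * \<epsilon>\<^sup>2"
      using N_le by (rule mult_right_mono) simp
    also have "\<dots> = (1 + 2 * I) * \<epsilon>"
      using eps by (simp add: power2_eq_square)
    finally have "real N * \<epsilon>\<^sup>2 \<le> (1 + 2 * I) * \<epsilon>" .
    moreover have "\<bar>\<tau> - integral {x0..r} (\<lambda>x. 1 / b x)\<bar> \<le> \<epsilon>"
      using tail_error[OF \<tau>, of r] r by simp
    moreover have "(2 + 2 * I + 1 / sqrt (b' x0)) * \<epsilon> = \<epsilon> + (1 + 2 * I) * \<epsilon> + \<epsilon> / sqrt (b' x0)"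
      by (simp add: algebra_simps)
    ultimately have "\<bar>euler_tau b x0 k Finv \<epsilon> - \<tau>\<bar> \<le> (2 + 2 * I + 1 / sqrt (b' x0)) * \<epsilon>"
      using time_error_up_to_r by linarith
    thus ?case
      using eps unique N_le X_reaches_r by (simp add: euler_halts_def r)
  qed
  show ?thesis
  proof (intro conjI bigoI)
    show "\<forall>\<^sub>F \<epsilon> in at_right 0. (\<exists>!y. 0 < y \<and> F y = \<epsilon>) \<and> euler_halts b x0 k Finv \<epsilon>"
      using main by eventually_elim simp
    show "\<forall>\<^sub>F \<epsilon> in at_right 0. norm \<bar>euler_tau b x0 k Finv \<epsilon> - \<tau>\<bar>
        \<le> (2 + 2 * I + 1 / sqrt (b' x0)) * norm \<epsilon>"
      using main by eventually_elim simp
    show "\<forall>\<^sub>F \<epsilon> in at_right 0. norm (real (euler_N b x0 k Finv \<epsilon>)) \<le> (1 + 2 * I) * norm (1 / \<epsilon>)"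
      using main by eventually_elim simp
  qed
qed

end
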